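(* Let $n\ge 1$ be an integer. If $P$ is chosen uniformly at random from the $2^{n-1}$ polynomials in $\mathbb{Z}_2[x]$ of degree $n$ with $P(0)\neq 0$, then the probability that $P$ is almost irreducible with some valid exponent (that is, for some exponent $r$ with $n/2 < r \le n$) is $\ln 2 + O(1/n)$.
   Context: $\mathbb{Z}_2 = \mathrm{GF}(2)$ is the field with two elements. A polynomial $P \in \mathbb{Z}_2[x]$ of degree $n$ is almost irreducible if $P(0)\neq 0$ and $P$ has an irreducible factor of degree $r$ for some $r > n/2$; one then says that $P$ has exponent $r$ and increment $n-r$. The constant implied by $O$ is absolute. *)

theory Defs
  imports
    "HOL-Library.Z2"
    "HOL-Computational_Algebra.Computational_Algebra"
    "HOL-Probability.Probability"
begin

definition almost_irreducible_with_exponent :: "bit poly \<Rightarrow> nat \<Rightarrow> bool" where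
  "almost_irreducible_with_exponent P r \<longleftrightarrow>
     poly P 0 \<noteq> 0 \<and> real r > real (degree P) / 2 \<and>
     (\<exists>Q. irreducible Q \<and> Q dvd P \<and> degree Q = r)"

definition almost_irreducible :: "bit poly \<Rightarrow> bool" where
  "almost_irreducible P \<longleftrightarrow> (\<exists>r. almost_irreducible_with_exponent P r)"

text \<open>The upper bound on the exponent is automatic.\<close>

lemma almost_irreducible_exponent_le:
  assumes "almost_irreducible_with_exponent P r"
  shows "r \<le> degree P"
proof -
  have "P \<noteq> 0" using assms by (auto simp: almost_irreducible_with_exponent_def)
  then show ?thesis
    using assms by (auto simp: almost_irreducible_with_exponent_def intro: dvd_imp_degree_le)
qed

definition polys_const_nz :: "nat \<Rightarrow> bit poly set" where
  "polys_const_nz n = {P. degree P = n \<and> poly P 0 \<noteq> 0}"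

text \<open>Since \<^const>\<open>pmf_of_set\<close> is only meaningful for finite nonempty sets, the size of the
  sample space is established here.\<close>

lemma card_polys_const_nz:
  assumes "n \<ge> 1"
  shows "card (polys_const_nz n) = 2 ^ (n - 1)"
proof -
  define F :: "nat set \<Rightarrow> bit poly" where
    "F A = monom 1 0 + monom 1 n + (\<Sum>i\<in>A. monom 1 i)" for A
  have coF: "coeff (F A) j = (if j = 0 \<or> j = n \<or> j \<in> A then 1 else 0)"
    if "A \<subseteq> {1..<n}" for A j
  proof -
    have fin: "finite A" using that finite_subset by blast
    have "(\<Sum>i\<in>A. coeff (monom 1 i) j) = (if j \<in> A then 1 else (0::bit))"
      using fin by (simp add: if_distrib sum.delta)
    then show ?thesis using that assms unfolding F_def by (auto simp: coeff_sum)
  qed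
  have "bij_betw F (Pow {1..<n}) (polys_const_nz n)"
  proof (rule bij_betw_byWitness[where f' = "\<lambda>P. {j \<in> {1..<n}. coeff P j = 1}"])
    show "\<forall>A\<in>Pow {1..<n}. {j \<in> {1..<n}. coeff (F A) j = 1} = A"
      using coF by auto
    show "\<forall>P\<in>polys_const_nz n. F {j \<in> {1..<n}. coeff P j = 1} = P"
    proof
      fix P assume P: "P \<in> polys_const_nz n"
      then have d: "degree P = n" and c0: "coeff P 0 \<noteq> 0"
        by (auto simp: polys_const_nz_def poly_0_coeff_0)
      have cn: "coeff P n \<noteq> 0" using d assms by (metis leading_coeff_0_iff c0 coeff_0)
      show "F {j \<in> {1..<n}. coeff P j = 1} = P"
      proof (rule poly_eqI)
        fix j
        have one: "x = 1" if "x \<noteq> 0" for x :: bit using that by (cases x) auto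
        have big: "coeff P j = 0" if "j > n" using that d by (simp add: coeff_eq_0)
        have "{j \<in> {1..<n}. coeff P j = 1} \<subseteq> {1..<n}" by auto
        from coF[OF this, of j]
        show "coeff (F {j \<in> {1..<n}. coeff P j = 1}) j = coeff P j"
          using one[of "coeff P j"] one[OF c0] one[OF cn] big
          by (cases "j = 0"; cases "j = n"; cases "j < n") auto
      qed
    qed
    show "F ` Pow {1..<n} \<subseteq> polys_const_nz n"
    proof
      fix P assume "P \<in> F ` Pow {1..<n}"
      then obtain A where A: "A \<subseteq> {1..<n}" "P = F A" by auto
      have "degree P = n"
        using coF[OF A(1)] A by (intro order_antisym degree_le le_degree) auto
      then show "P \<in> polys_const_nz n"
        using coF[OF A(1), of 0] A(2) by (simp add: polys_const_nz_def poly_0_coeff_0)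
    qed
    show "(\<lambda>P. {j \<in> {1..<n}. coeff P j = 1}) ` polys_const_nz n \<subseteq> Pow {1..<n}"
      by auto
  qed
  then have "card (polys_const_nz n) = card (Pow {1..<n})"
    by (simp add: bij_betw_same_card)
  then show ?thesis by (simp add: card_Pow)
qed

lemma finite_polys_const_nz:
  "n \<ge> 1 \<Longrightarrow> finite (polys_const_nz n) \<and> polys_const_nz n \<noteq> {}"
  using card_polys_const_nz[of n] card_gt_0_iff[of "polys_const_nz n"] by simp

end

theory Submission
  imports Defs
begin

text \<open>Comparing degrees on both sides of the unique factorisation of \<open>f\<close> gives
  \<open>deg f = (\<Sum>P. \<Sum>k\<ge>1. deg P * [P^k dvd f])\<close>. Summed over the \<open>2^n\<close> polynomials \<open>f\<close> of degree
  \<open>n\<close> over GF(2) this reads \<open>n * 2^n = (\<Sum>m=1..n. 2^(n-m) * L m)\<close> with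
  \<open>L m = (\<Sum>P | deg P dvd m. deg P)\<close>, and comparing consecutive \<open>n\<close> yields Gauss' formula
  \<open>L n = 2^n\<close>. Hence the number \<open>I r\<close> of irreducible polynomials of degree \<open>r\<close> satisfies
  \<open>I r / 2^r = 1/r + O(1/r^2)\<close>. A polynomial of degree \<open>n\<close> has at most one irreducible factor of
  degree exceeding \<open>n/2\<close>, so the probability in question is
  \<open>(\<Sum>n/2<r\<le>n. I r / 2^r) + O(1/n)\<close>, which is a piece of the harmonic series tending to \<open>ln 2\<close>.\<close>

section \<open>Divisibility of polynomials over GF(2)\<close>

text \<open>A divisor of least positive degree cannot split into two nonconstant factors, as each
  factor would again be a divisor of \<open>f\<close>.\<close>

lemma degree_pos_irreducible_dvd:
  fixes f :: "'a::field poly"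
  assumes "degree f > 0"
  obtains Q where "irreducible Q" "Q dvd f"
proof -
  have "f dvd f \<and> degree f > 0" using assms by simp
  then obtain Q where Q: "Q dvd f" "degree Q > 0"
    and min: "\<And>R. R dvd f \<Longrightarrow> degree R > 0 \<Longrightarrow> degree Q \<le> degree R"
    using ex_has_least_nat[of "\<lambda>Q. Q dvd f \<and> degree Q > 0" f degree] by blast
  have "irreducible Q"
  proof (rule irreducibleI)
    show Q0: "Q \<noteq> 0" using Q by auto
    show "\<not> Q dvd 1" using Q is_unit_iff_degree[OF Q0] by simp
    fix a b assume ab: "Q = a * b"
    with Q0 have nz: "a \<noteq> 0" "b \<noteq> 0" by auto
    show "a dvd 1 \<or> b dvd 1"
    proof (cases "degree a = 0")
      case True
      then show ?thesis using is_unit_iff_degree[OF nz(1)] by simp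
    next
      case False
      have "a dvd f" using ab Q(1) by (meson dvd_mult_left)
      with False min have "degree Q \<le> degree a" by simp
      with ab nz have "degree b = 0" by (simp add: degree_mult_eq)
      then show ?thesis using is_unit_iff_degree[OF nz(2)] by simp
    qed
  qed
  with Q that show thesis by blast
qed

lemma irreducible_degree_pos:
  fixes P :: "'a::field poly"
  assumes "irreducible P"
  shows "degree P > 0"
proof -
  have "P \<noteq> 0" "\<not> P dvd 1" using assms by (auto simp: irreducible_def)
  then show ?thesis using is_unit_iff_degree by blast
qed

text \<open>Over GF(2) the unit group is trivial. Hence associated polynomials are equal, and
  irreducible factors can be counted without normalising them.\<close>

lemma bit_poly_degree_0:
  fixes c :: "bit poly"
  assumes "c \<noteq> 0" "degree c = 0"
  shows "c = 1"
proof -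
  obtain a where "c = [:a:]" using degree0_coeffs[OF assms(2)] by auto
  with assms(1) show ?thesis by (cases a) (auto simp: one_pCons)
qed

lemma bit_poly_irreducible_dvd_eq:
  fixes P Q :: "bit poly"
  assumes "irreducible P" "irreducible Q" "P dvd Q"
  shows "P = Q"
proof -
  obtain c where c: "Q = P * c" using assms(3) by auto
  have "\<not> P dvd 1" using assms(1) by (simp add: irreducible_def)
  then have "c dvd 1" using irreducibleD[OF assms(2) c] by simp
  moreover have "c \<noteq> 0" using assms(2) c by auto
  ultimately have "c = 1" using bit_poly_degree_0 is_unit_iff_degree by blast
  with c show ?thesis by simp
qed

section \<open>Counting polynomials and multiples of given degree\<close>

definition nonzero_of_degree :: "nat \<Rightarrow> bit poly set" where
  "nonzero_of_degree n = {f. f \<noteq> 0 \<and> degree f = n}"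

text \<open>The map f -> 1 + x*f shifts the degree by one and hits exactly the polynomials with
  nonzero constant term, whose number is known. Excluding 0, whose \<open>degree\<close> is 0, makes
  the count right for \<open>n = 0\<close> as well.\<close>

lemma card_nonzero_of_degree: "card (nonzero_of_degree n) = 2 ^ n"
proof -
  have "bij_betw (pCons 1) (nonzero_of_degree n) (polys_const_nz (Suc n))"
  proof (rule bij_betw_imageI)
    show "inj_on (pCons 1) (nonzero_of_degree n)" by (auto simp: inj_on_def)
    show "pCons 1 ` nonzero_of_degree n = polys_const_nz (Suc n)"
    proof (intro equalityI subsetI)
      fix f assume "f \<in> pCons 1 ` nonzero_of_degree n"
      then show "f \<in> polys_const_nz (Suc n)"
        by (auto simp: polys_const_nz_def nonzero_of_degree_def)
    next
      fix f assume f: "f \<in> polys_const_nz (Suc n)"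
      obtain a g where ag: "f = pCons a g" by (cases f)
      have "a = 1" "g \<noteq> 0" "degree g = n"
        using f unfolding ag polys_const_nz_def by (auto split: if_splits)
      then show "f \<in> pCons 1 ` nonzero_of_degree n"
        using ag by (auto simp: nonzero_of_degree_def)
    qed
  qed
  then show ?thesis using card_polys_const_nz[of "Suc n"] by (simp add: bij_betw_same_card)
qed

lemma finite_nonzero_of_degree [simp]: "finite (nonzero_of_degree n)"
  by (rule card_ge_0_finite) (simp add: card_nonzero_of_degree)

lemma card_multiples:
  fixes P :: "bit poly"
  assumes "P \<noteq> 0"
  shows "card {f \<in> nonzero_of_degree n. P dvd f} =
    (if degree P \<le> n then 2 ^ (n - degree P) else 0)"
proof (cases "degree P \<le> n")
  case True
  have "bij_betw ((*) P) (nonzero_of_degree (n - degree P)) {f \<in> nonzero_of_degree n. P dvd f}"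
  proof (rule bij_betw_imageI)
    show "inj_on ((*) P) (nonzero_of_degree (n - degree P))"
      using assms by (auto simp: inj_on_def)
    show "(*) P ` nonzero_of_degree (n - degree P) = {f \<in> nonzero_of_degree n. P dvd f}"
      using assms True by (auto simp: nonzero_of_degree_def degree_mult_eq dvd_def)
  qed
  from bij_betw_same_card[OF this] show ?thesis using True by (simp add: card_nonzero_of_degree)
next
  case False
  then have "{f \<in> nonzero_of_degree n. P dvd f} = {}"
    by (auto simp: nonzero_of_degree_def dest: dvd_imp_degree_le)
  then show ?thesis using False by simp
qed

section \<open>Counting irreducible polynomials\<close>

text \<open>A finite index set common to all polynomials of degree at most \<open>n\<close>, so that
  sums over irreducible factors can be interchanged with sums over polynomials.\<close>

definition irreducibles_upto :: "nat \<Rightarrow> bit poly set" where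
  "irreducibles_upto n = {P. irreducible P \<and> degree P \<le> n}"

definition irreducibles_of_degree :: "nat \<Rightarrow> bit poly set" where
  "irreducibles_of_degree n = {P. irreducible P \<and> degree P = n}"

lemma irreducibles_of_degree_iff:
  "P \<in> irreducibles_of_degree n \<longleftrightarrow> irreducible P \<and> degree P = n"
  by (simp add: irreducibles_of_degree_def)

lemma finite_irreducibles_upto [simp]: "finite (irreducibles_upto n)"
proof (rule finite_subset)
  show "irreducibles_upto n \<subseteq> (\<Union>d\<le>n. nonzero_of_degree d)"
    by (auto simp: irreducibles_upto_def nonzero_of_degree_def)
qed simp

lemma finite_irreducibles_of_degree [simp]: "finite (irreducibles_of_degree n)"
  by (rule finite_subset[OF _ finite_irreducibles_upto[of n]])
    (auto simp: irreducibles_upto_def irreducibles_of_degree_def)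

section \<open>Degree as a sum over prime powers, and Gauss' formula\<close>

lemma prime_elem_power_dvd_mult_iff:
  fixes P Q g :: "'a::algebraic_semidom"
  assumes "prime_elem P" "\<not> P dvd Q"
  shows "P ^ k dvd Q * g \<longleftrightarrow> P ^ k dvd g"
proof
  show "P ^ k dvd g" if "P ^ k dvd Q * g"
    using that
  proof (induction k arbitrary: g)
    case (Suc k)
    have "P dvd Q * g" using Suc.prems by (auto dest: dvd_mult_left)
    then have "P dvd g" using assms by (simp add: prime_elem_dvd_mult_iff)
    then obtain h where h: "g = P * h" by auto
    have "P * P ^ k dvd P * (Q * h)" using Suc.prems by (simp add: h ac_simps)
    then have "P ^ k dvd Q * h" using assms(1) by auto
    then have "P ^ k dvd h" by (rule Suc.IH)
    then show ?case by (simp add: h mult_dvd_mono)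
  qed simp
qed simp

text \<open>The inner sum is the multiplicity of \<open>P\<close> in \<open>f\<close>; cutting it
  off at \<open>N\<close> is harmless because \<open>P ^ k dvd f\<close> forces k <=
  \<open>degree f\<close>. Splitting off one irreducible factor \<open>Q\<close> raises the
  multiplicity of \<open>Q\<close> by one and leaves the others alone, which gives an induction on
  the degree.\<close>

lemma degree_eq_sum_irreducible_powers:
  fixes f :: "bit poly"
  assumes "f \<noteq> 0" "degree f \<le> N"
  shows "degree f = (\<Sum>P\<in>irreducibles_upto N. degree P * (\<Sum>k=1..N. of_bool (P ^ k dvd f)))"
  using assms
proof (induction "degree f" arbitrary: f rule: less_induct)
  case less
  show ?case
  proof (cases "degree f = 0")
    case True
    then have f: "f = 1" using less.prems bit_poly_degree_0 by blast
    have "\<not> P ^ k dvd 1" if "P \<in> irreducibles_upto N" "k \<in> {1..N}" for P k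
      using that by (auto simp: irreducibles_upto_def irreducible_def is_unit_power_iff)
    then show ?thesis by (simp add: f)
  next
    case False
    then obtain Q where Q: "irreducible Q" "Q dvd f" using degree_pos_irreducible_dvd by blast
    then obtain g where g: "f = Q * g" by auto
    have nz: "Q \<noteq> 0" "g \<noteq> 0" using g less.prems by auto
    have df: "degree f = degree Q + degree g" using g nz by (simp add: degree_mult_eq)
    have QN: "Q \<in> irreducibles_upto N" using Q df less.prems by (simp add: irreducibles_upto_def)
    define M where "M P f = (\<Sum>k=1..N. of_bool (P ^ k dvd f) :: nat)" for P f :: "bit poly"
    have M: "M P f = M P g + (if P = Q then 1 else 0)" if "P \<in> irreducibles_upto N" for P
    proof (cases "P = Q")
      case True
      \<comment> \<open>\<open>Q ^ k dvd Q * g\<close> amounts to \<open>Q ^ (k - 1) dvd g\<close>,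
        so the count for \<open>f\<close> is the count for \<open>g\<close> over exponents 0 to N -
        1. Exponent 0 supplies the extra 1, and the missing exponent \<open>N\<close> contributes
        nothing because \<open>Q ^ N\<close> has larger degree than \<open>g\<close>.\<close>
      have "N \<le> N * degree Q" using mult_le_mono2[of 1 "degree Q" N] irreducible_degree_pos[OF Q(1)] by simp
      moreover have "degree g < N"
        using df less.prems irreducible_degree_pos[OF Q(1)] by simp
      ultimately have "degree g < N * degree Q" by (metis less_le_trans)
      then have "degree g < degree (Q ^ N)" using nz by (simp add: degree_power_eq)
      then have "\<not> Q ^ N dvd g" by (meson dvd_imp_degree_le leD nz(2))
      moreover have "M Q f = (\<Sum>k<N. of_bool (Q ^ k dvd g))"
        unfolding M_def g One_nat_def sum.atLeast1_atMost_eq using nz by (intro sum.cong refl) simp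
      moreover have "{..N} = insert 0 {1..N}" "{..N} = insert N {..<N}" by auto
      then have "(\<Sum>k\<in>insert 0 {1..N}. of_bool (Q ^ k dvd g) :: nat) =
          (\<Sum>k\<in>insert N {..<N}. of_bool (Q ^ k dvd g))" by metis
      ultimately show ?thesis using True by (simp add: M_def)
    next
      case False
      have P: "irreducible P" using that by (simp add: irreducibles_upto_def)
      then have "prime_elem P" "\<not> P dvd Q"
        using field_poly_irreducible_imp_prime bit_poly_irreducible_dvd_eq Q False by blast+
      then show ?thesis using False g by (simp add: M_def prime_elem_power_dvd_mult_iff)
    qed
    have "(\<Sum>P\<in>irreducibles_upto N. degree P * M P f) =
      (\<Sum>P\<in>irreducibles_upto N. degree P * M P g + (if P = Q then degree P else 0))"
      by (intro sum.cong) (auto simp: M distrib_left)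
    also have "\<dots> = (\<Sum>P\<in>irreducibles_upto N. degree P * M P g) + degree Q"
      using QN by (simp add: sum.distrib)
    also have "(\<Sum>P\<in>irreducibles_upto N. degree P * M P g) = degree g"
      unfolding M_def using less.hyps[of g] less.prems df nz irreducible_degree_pos[OF Q(1)] by simp
    finally show ?thesis using df by (simp add: M_def)
  qed
qed

text \<open>At most one \<open>k\<close> can satisfy the equation because \<open>m\<close> is
  positive, and such a \<open>k\<close> is at most \<open>m\<close>. This collapses the sum over
  exponents into a divisibility condition on degrees.\<close>

lemma sum_of_bool_mult_eq:
  fixes d m n :: nat
  assumes "1 \<le> m" "m \<le> n"
  shows "(\<Sum>k=1..n. of_bool (m = k * d)) = (of_bool (d dvd m) :: nat)"
proof (cases "d dvd m")
  case True
  then obtain j where j: "m = d * j" by auto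
  with assms have pos: "d > 0" "j > 0" by auto
  then have "j \<le> d * j" by simp
  then have "j \<le> n" using assms(2) j by (metis le_trans)
  then have "j \<in> {1..n}" using pos by simp
  moreover have "m = k * d \<longleftrightarrow> k = j" for k using j pos by auto
  ultimately show ?thesis using True by (simp add: of_bool_def)
next
  case False
  then have "m \<noteq> k * d" for k by auto
  then show ?thesis using False by simp
qed

lemma sum_irreducible_power_multiples:
  "n * 2 ^ n = (\<Sum>m=1..n. 2 ^ (n - m) * (\<Sum>P | irreducible P \<and> degree P dvd m. degree (P::bit poly)))"
proof -
  have "n * 2 ^ n = (\<Sum>f\<in>nonzero_of_degree n. degree f)"
    by (simp add: nonzero_of_degree_def card_nonzero_of_degree[unfolded nonzero_of_degree_def])
  also have "\<dots> = (\<Sum>f\<in>nonzero_of_degree n. \<Sum>P\<in>irreducibles_upto n. \<Sum>k=1..n.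
      degree P * of_bool (P ^ k dvd f))"
  proof (rule sum.cong[OF refl])
    fix f assume "f \<in> nonzero_of_degree n"
    then have f: "f \<noteq> 0" "degree f \<le> n" by (auto simp: nonzero_of_degree_def)
    show "degree f = (\<Sum>P\<in>irreducibles_upto n. \<Sum>k=1..n. degree P * of_bool (P ^ k dvd f))"
      using degree_eq_sum_irreducible_powers[OF f] by (simp only: sum_distrib_left)
  qed
  also have "\<dots> = (\<Sum>P\<in>irreducibles_upto n. \<Sum>k=1..n. \<Sum>f\<in>nonzero_of_degree n.
      degree P * of_bool (P ^ k dvd f))"
    by (subst sum.swap) (intro sum.cong refl sum.swap)
  \<comment> \<open>The new index \<open>m\<close> stands for the degree of \<open>P ^ k\<close>;
    grouping the prime powers by \<open>m\<close> makes the weight \<open>2 ^ (n - m)\<close>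
    independent of \<open>P\<close> and \<open>k\<close>.\<close>
  also have "\<dots> = (\<Sum>P\<in>irreducibles_upto n. \<Sum>k=1..n. \<Sum>m=1..n.
      2 ^ (n - m) * (degree P * of_bool (m = k * degree P)))"
  proof (intro sum.cong refl)
    fix P k assume P: "P \<in> irreducibles_upto n" and k: "k \<in> {1..n}"
    then have P0: "P \<noteq> 0" and d: "degree P > 0"
      using irreducible_degree_pos[of P] by (auto simp: irreducibles_upto_def)
    have "(\<Sum>f\<in>nonzero_of_degree n. degree P * of_bool (P ^ k dvd f)) =
        degree P * card {f \<in> nonzero_of_degree n. P ^ k dvd f}"
      by (simp add: of_bool_def flip: sum_distrib_left sum.inter_filter)
    also have "\<dots> = degree P * (if k * degree P \<le> n then 2 ^ (n - k * degree P) else 0)"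
      using card_multiples[of "P ^ k" n] P0 by (simp add: degree_power_eq mult.commute)
    also have "\<dots> = (\<Sum>m=1..n. if m = k * degree P then degree P * 2 ^ (n - m) else 0)"
      using k d by (subst sum.delta) auto
    also have "\<dots> = (\<Sum>m=1..n. 2 ^ (n - m) * (degree P * of_bool (m = k * degree P)))"
      by (intro sum.cong) auto
    finally show "(\<Sum>f\<in>nonzero_of_degree n. degree P * of_bool (P ^ k dvd f)) = \<dots>" .
  qed
  also have "\<dots> = (\<Sum>P\<in>irreducibles_upto n. \<Sum>m=1..n. \<Sum>k=1..n.
      2 ^ (n - m) * (degree P * of_bool (m = k * degree P)))"
    by (intro sum.cong refl sum.swap)
  also have "\<dots> = (\<Sum>m=1..n. \<Sum>P\<in>irreducibles_upto n. \<Sum>k=1..n.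
      2 ^ (n - m) * (degree P * of_bool (m = k * degree P)))"
    by (rule sum.swap)
  also have "\<dots> = (\<Sum>m=1..n. 2 ^ (n - m) *
      (\<Sum>P | irreducible P \<and> degree P dvd m. degree (P::bit poly)))"
  proof (rule sum.cong[OF refl])
    fix m assume m: "m \<in> {1..n}"
    have "(\<Sum>P\<in>irreducibles_upto n. \<Sum>k=1..n. 2 ^ (n - m) * (degree P * of_bool (m = k * degree P))) =
      2 ^ (n - m) * (\<Sum>P\<in>irreducibles_upto n. degree P * (\<Sum>k=1..n. of_bool (m = k * degree P)))"
      by (simp only: sum_distrib_left)
    also have "(\<Sum>P\<in>irreducibles_upto n. degree P * (\<Sum>k=1..n. of_bool (m = k * degree P))) =
      (\<Sum>P\<in>irreducibles_upto n. if degree P dvd m then degree P else 0)"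
      using m sum_of_bool_mult_eq[of m n] by (intro sum.cong refl) auto
    also have "\<dots> = (\<Sum>P | P \<in> irreducibles_upto n \<and> degree P dvd m. degree P)"
      by (simp add: sum.inter_filter)
    also have "{P. P \<in> irreducibles_upto n \<and> degree P dvd m} = {P. irreducible P \<and> degree P dvd m}"
      using m by (auto simp: irreducibles_upto_def dest: dvd_imp_le)
    finally show "(\<Sum>P\<in>irreducibles_upto n. \<Sum>k=1..n.
        2 ^ (n - m) * (degree P * of_bool (m = k * degree P))) =
      2 ^ (n - m) * (\<Sum>P | irreducible P \<and> degree P dvd m. degree (P::bit poly))" .
  qed
  finally show ?thesis .
qed

theorem sum_degree_irreducibles_dvd:
  assumes "n \<ge> 1"
  shows "(\<Sum>P | irreducible P \<and> degree P dvd n. degree (P::bit poly)) = 2 ^ n"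
proof -
  define L where "L m = (\<Sum>P | irreducible P \<and> degree P dvd m. degree (P::bit poly))" for m
  have S: "n * 2 ^ n = (\<Sum>m=1..n. 2 ^ (n - m) * L m)" for n
    unfolding L_def by (rule sum_irreducible_power_multiples)
  obtain k where k: "n = Suc k" using assms by (cases n) auto
  have "n * 2 ^ n = (\<Sum>m=1..k. 2 ^ (Suc k - m) * L m) + L n"
    unfolding S[of n] by (simp add: k)
  \<comment> \<open>All terms but the last are twice those of the identity for \<open>k\<close>, so
    \<open>L n\<close> equals (k + 1) * 2^(k+1) - 2 * k * 2^k = 2^(k+1).\<close>
  also have "(\<Sum>m=1..k. 2 ^ (Suc k - m) * L m) = 2 * (\<Sum>m=1..k. 2 ^ (k - m) * L m)"
    unfolding sum_distrib_left by (intro sum.cong) (auto simp: Suc_diff_le)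
  also have "\<dots> = 2 * (k * 2 ^ k)" by (simp only: S)
  finally show ?thesis by (simp add: k flip: L_def)
qed

section \<open>Density of irreducible polynomials\<close>

lemma degree_mult_card_irreducibles_le:
  assumes "n \<ge> 1"
  shows "n * card (irreducibles_of_degree n) \<le> 2 ^ n"
proof -
  have "n * card (irreducibles_of_degree n) = (\<Sum>P\<in>irreducibles_of_degree n. degree P)"
    by (simp add: irreducibles_of_degree_def)
  also have "\<dots> \<le> (\<Sum>P | irreducible P \<and> degree P dvd n. degree (P::bit poly))"
  proof (rule sum_mono2)
    show "finite {P::bit poly. irreducible P \<and> degree P dvd n}"
      by (rule finite_subset[OF _ finite_irreducibles_upto[of n]])
        (use assms in \<open>auto simp: irreducibles_upto_def dest: dvd_imp_le\<close>)
  qed (auto simp: irreducibles_of_degree_def)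
  also have "\<dots> = 2 ^ n" by (rule sum_degree_irreducibles_dvd[OF assms])
  finally show ?thesis .
qed

text \<open>In Gauss' formula every degree other than \<open>n\<close> is a proper divisor of
  \<open>n\<close>, hence at most \<open>n div 2\<close>. The upper bound, applied to each smaller
  degree, leaves a geometric sum as error.\<close>

lemma degree_mult_card_irreducibles_ge:
  assumes "n \<ge> 1"
  shows "2 ^ n \<le> n * card (irreducibles_of_degree n) + 2 ^ Suc (n div 2)"
proof -
  have "2 ^ n = (\<Sum>P | irreducible P \<and> degree P dvd n. degree (P::bit poly))"
    by (rule sum_degree_irreducibles_dvd[OF assms, symmetric])
  also have "\<dots> \<le> (\<Sum>P\<in>irreducibles_of_degree n \<union> (\<Union>d\<in>{1..n div 2}. irreducibles_of_degree d). degree P)"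
  proof (rule sum_mono2)
    show "{P::bit poly. irreducible P \<and> degree P dvd n}
      \<subseteq> irreducibles_of_degree n \<union> (\<Union>d\<in>{1..n div 2}. irreducibles_of_degree d)"
    proof
      fix P :: "bit poly" assume "P \<in> {P. irreducible P \<and> degree P dvd n}"
      then have P: "irreducible P" "degree P dvd n" by auto
      then obtain c where c: "n = degree P * c" by auto
      have "degree P \<in> {1..n div 2}" if "degree P \<noteq> n"
      proof -
        have "c \<ge> 2" using that c assms by (cases c; cases "c - 1") auto
        then have "degree P * 2 \<le> n" using c by simp
        then show ?thesis using irreducible_degree_pos[OF P(1)] by auto
      qed
      then show "P \<in> irreducibles_of_degree n \<union> (\<Union>d\<in>{1..n div 2}. irreducibles_of_degree d)"
        using P(1) by (auto simp: irreducibles_of_degree_def)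
    qed
  qed auto
  also have "\<dots> \<le> (\<Sum>P\<in>irreducibles_of_degree n. degree P) +
      (\<Sum>P\<in>(\<Union>d\<in>{1..n div 2}. irreducibles_of_degree d). degree P)"
    by (subst sum.union_inter[symmetric]) auto
  also have "(\<Sum>P\<in>(\<Union>d\<in>{1..n div 2}. irreducibles_of_degree d). degree P) =
      (\<Sum>d=1..n div 2. \<Sum>P\<in>irreducibles_of_degree d. degree P)"
    by (rule sum.UNION_disjoint) (auto simp: irreducibles_of_degree_iff)
  also have "\<dots> = (\<Sum>d=1..n div 2. d * card (irreducibles_of_degree d))"
    by (simp add: irreducibles_of_degree_def mult.commute)
  also have "\<dots> \<le> (\<Sum>d=1..n div 2. 2 ^ d)"
    by (intro sum_mono degree_mult_card_irreducibles_le) simp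
  also have "\<dots> \<le> (\<Sum>d<Suc (n div 2). 2 ^ d)"
    by (intro sum_mono2) auto
  also have "\<dots> \<le> 2 ^ Suc (n div 2)"
    using sum_power2[of "Suc (n div 2)"] by (simp add: lessThan_atLeast0 del: power_Suc)
  also have "(\<Sum>P\<in>irreducibles_of_degree n. degree P) = n * card (irreducibles_of_degree n)"
    by (simp add: irreducibles_of_degree_def)
  finally show ?thesis by simp
qed

lemma irreducibles_density:
  assumes "r \<ge> 1"
  shows "\<bar>real (card (irreducibles_of_degree r)) / 2 ^ r - 1 / real r\<bar> \<le> 4 / real r ^ 2"
    and "real (card (irreducibles_of_degree r)) / 2 ^ r \<le> 1 / real r"
proof -
  define I where "I = real (card (irreducibles_of_degree r))"
  have r: "real r > 0" using assms by simp
  have "real (r * card (irreducibles_of_degree r)) \<le> real (2 ^ r)"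
    using degree_mult_card_irreducibles_le[OF assms] of_nat_le_iff by blast
  then have up: "real r * I \<le> 2 ^ r" by (simp add: I_def)
  then show le: "real (card (irreducibles_of_degree r)) / 2 ^ r \<le> 1 / real r"
    using r by (simp add: I_def[symmetric] field_simps)
  have "real (2 ^ r) \<le> real (r * card (irreducibles_of_degree r) + 2 ^ Suc (r div 2))"
    using degree_mult_card_irreducibles_ge[OF assms] of_nat_le_iff by blast
  then have lo: "2 ^ r \<le> real r * I + 2 * 2 ^ (r div 2)" by (simp add: I_def)
  \<comment> \<open>Source of the 4: \<open>r\<close> is at most twice \<open>2 ^ (r div 2)\<close>,
    so \<open>r * 2 ^ (r div 2)\<close> is at most \<open>2 * 2 ^ r\<close>, and \<open>lo\<close>
    has its error term with a further factor 2.\<close>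
  have "r div 2 + 1 \<le> 2 ^ (r div 2)" by (simp add: Suc_leI)
  then have "real (r div 2 + 1) \<le> 2 ^ (r div 2)"
    by (metis of_nat_le_iff of_nat_numeral of_nat_power)
  moreover have "r \<le> 2 * (r div 2 + 1)" by presburger
  then have "real r \<le> 2 * real (r div 2 + 1)" by linarith
  ultimately have "real r * 2 ^ (r div 2) \<le> 2 * 2 ^ (r div 2) * 2 ^ (r div 2)"
    by (intro mult_right_mono) auto
  also have "\<dots> = 2 * (2::real) ^ (r div 2 + r div 2)" by (simp add: power_add)
  also have "\<dots> \<le> 2 * 2 ^ r" by (intro mult_left_mono power_increasing) auto
  finally have "2 ^ r * real r \<le> (real r * I) * real r + 4 * 2 ^ r"
    using mult_right_mono[OF lo, of "real r"] r by (simp add: algebra_simps)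
  then have "(2 ^ r * real r - real r * I * real r) / (2 ^ r * real r ^ 2)
      \<le> 4 * 2 ^ r / (2 ^ r * real r ^ 2)"
    by (intro divide_right_mono) auto
  moreover have "(2 ^ r * real r - real r * I * real r) / (2 ^ r * real r ^ 2) = 1 / real r - I / 2 ^ r"
    using r by (simp add: field_simps power2_eq_square)
  ultimately have "1 / real r - I / 2 ^ r \<le> 4 / real r ^ 2" by simp
  with le show "\<bar>real (card (irreducibles_of_degree r)) / 2 ^ r - 1 / real r\<bar> \<le> 4 / real r ^ 2"
    by (simp add: I_def)
qed

section \<open>Almost irreducible polynomials\<close>

text \<open>This counts the cofactor of a polynomial that is itself irreducible. The value 1 is
  twice what the pattern 2^(k-1) would give at k = 0, which causes the extra term in
  \<open>prob_almost_irreducible\<close>.\<close>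

lemma card_polys_const_nz_0: "card (polys_const_nz 0) = 1"
proof -
  have "polys_const_nz 0 = {1}"
  proof (intro equalityI subsetI)
    fix f assume "f \<in> polys_const_nz 0"
    then have "degree f = 0" "f \<noteq> 0" by (auto simp: polys_const_nz_def)
    then have "f = 1" using bit_poly_degree_0 by blast
    then show "f \<in> {1}" by simp
  qed (simp add: polys_const_nz_def)
  then show ?thesis by simp
qed

lemma irreducible_poly_0_nz:
  fixes Q :: "'a::field poly"
  assumes "irreducible Q" "degree Q \<ge> 2"
  shows "poly Q 0 \<noteq> 0"
proof
  assume "poly Q 0 = 0"
  then have "[:0, 1:] dvd Q" using poly_eq_0_iff_dvd[of Q 0] by simp
  then obtain c where c: "Q = [:0, 1:] * c" by auto
  have nz: "c \<noteq> 0" using assms(2) c by auto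
  have "\<not> [:0, 1::'a:] dvd 1" by (simp add: is_unit_iff_degree)
  then have "c dvd 1" using irreducibleD[OF assms(1) c] by blast
  then have "degree c = 0" using is_unit_iff_degree nz by blast
  then have "degree Q = 1" using nz by (simp add: c degree_mult_eq)
  then show False using assms(2) by simp
qed

text \<open>Each such polynomial is \<open>Q * g\<close> for exactly one pair, since an irreducible
  factor of degree above n/2 is unique. For \<open>n = 1\<close> the formula would fail, as
  \<open>Q\<close> could be x.\<close>

lemma card_almost_irreducible:
  assumes "n \<ge> 2"
  shows "card (polys_const_nz n \<inter> {P. almost_irreducible P}) =
    (\<Sum>r=Suc (n div 2)..n. card (irreducibles_of_degree r) * card (polys_const_nz (n - r)))"
proof -
  define X where "X = (\<Union>r\<in>{Suc (n div 2)..n}. irreducibles_of_degree r \<times> polys_const_nz (n - r))"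
  have fin: "finite (polys_const_nz k)" for k
    using finite_polys_const_nz[of k] card_polys_const_nz_0
    by (cases k) (auto intro: card_ge_0_finite)
  have "bij_betw (\<lambda>(Q, g). Q * g) X (polys_const_nz n \<inter> {P. almost_irreducible P})"
  proof (rule bij_betw_imageI)
    show "inj_on (\<lambda>(Q, g). Q * g) X"
    proof (rule inj_onI, clarify)
      fix Q g Q' g'
      assume X: "(Q, g) \<in> X" "(Q', g') \<in> X" and eq: "Q * g = Q' * g'"
      have irr: "irreducible Q" "irreducible Q'" and deg: "degree Q > n div 2" "degree Q' > n div 2"
        and g': "g' \<noteq> 0" "degree g' = n - degree Q'"
        using X by (auto simp: X_def irreducibles_of_degree_def polys_const_nz_def)
      have "Q dvd Q' * g'" using eq by (metis dvd_triv_left)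
      \<comment> \<open>The cofactor \<open>g'\<close> has degree at most \<open>n div 2\<close>,
        too small to be a multiple of \<open>Q\<close>.\<close>
      moreover have "\<not> Q dvd g'" using g' deg by (auto dest: dvd_imp_degree_le)
      ultimately have "Q dvd Q'"
        using field_poly_irreducible_imp_prime[OF irr(1)] by (simp add: prime_elem_dvd_mult_iff)
      then have "Q = Q'" by (rule bit_poly_irreducible_dvd_eq[OF irr])
      then show "Q = Q' \<and> g = g'" using eq irr(1) by auto
    qed
    show "(\<lambda>(Q, g). Q * g) ` X = polys_const_nz n \<inter> {P. almost_irreducible P}"
    proof (intro equalityI subsetI)
      fix P assume "P \<in> (\<lambda>(Q, g). Q * g) ` X"
      then obtain Q g where X: "(Q, g) \<in> X" and P: "P = Q * g" by auto
      define r where "r = degree Q"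
      have r: "n div 2 < r" "r \<le> n" and Q: "irreducible Q" "degree Q = r"
        and g: "degree g = n - r" "poly g 0 \<noteq> 0"
        using X by (auto simp: X_def irreducibles_of_degree_iff polys_const_nz_def r_def)
      \<comment> \<open>From \<open>n \<ge> 2\<close> and \<open>r > n div 2\<close> it follows that
        \<open>r \<ge> 2\<close>, so \<open>Q\<close> is not x.\<close>
      have nz: "poly P 0 \<noteq> 0"
        using irreducible_poly_0_nz[of Q] Q r assms g by (simp add: P)
      have "Q \<noteq> 0" "g \<noteq> 0" using nz by (auto simp: P)
      then have deg: "degree P = n" using Q g r by (simp add: P degree_mult_eq)
      have "real r > real n / 2" using r by linarith
      then have "almost_irreducible_with_exponent P r"
        using nz deg Q P by (auto simp: almost_irreducible_with_exponent_def)
      then show "P \<in> polys_const_nz n \<inter> {P. almost_irreducible P}"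
        using nz deg by (auto simp: polys_const_nz_def almost_irreducible_def)
    next
      fix P assume "P \<in> polys_const_nz n \<inter> {P. almost_irreducible P}"
      then obtain Q where P: "degree P = n" "poly P 0 \<noteq> 0" and Q: "irreducible Q" "Q dvd P"
        "real (degree Q) > real n / 2"
        by (auto simp: polys_const_nz_def almost_irreducible_def almost_irreducible_with_exponent_def)
      then obtain g where g: "P = Q * g" by auto
      have nz: "Q \<noteq> 0" "g \<noteq> 0" "poly g 0 \<noteq> 0" using P g by auto
      have deg: "n = degree Q + degree g" using P g nz by (simp add: degree_mult_eq)
      have "n div 2 < degree Q" using Q(3) by linarith
      then have "(Q, g) \<in> X"
        using Q(1) nz deg by (auto simp: X_def irreducibles_of_degree_def polys_const_nz_def)
      then show "P \<in> (\<lambda>(Q, g). Q * g) ` X" using g by force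
    qed
  qed
  then have "card (polys_const_nz n \<inter> {P. almost_irreducible P}) = card X"
    by (simp add: bij_betw_same_card)
  also have "\<dots> = (\<Sum>r=Suc (n div 2)..n. card (irreducibles_of_degree r \<times> polys_const_nz (n - r)))"
    unfolding X_def
    by (rule card_UN_disjoint) (auto simp: fin irreducibles_of_degree_iff)
  finally show ?thesis by (simp add: card_cartesian_product)
qed

lemma prob_almost_irreducible:
  assumes "n \<ge> 2"
  shows "measure_pmf.prob (pmf_of_set (polys_const_nz n)) {P. almost_irreducible P} =
    (\<Sum>r=Suc (n div 2)..n. real (card (irreducibles_of_degree r)) / 2 ^ r)
    + real (card (irreducibles_of_degree n)) / 2 ^ n"
proof -
  define I where "I r = real (card (irreducibles_of_degree r))" for r
  \<comment> \<open>For r < n the quotient is 2^(n-r-1) / 2^(n-1); for r = n it is 1 / 2^(n-1),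
    which is twice 1 / 2^n.\<close>
  have weight: "real (card (polys_const_nz (n - r))) / 2 ^ (n - 1) =
      1 / 2 ^ r + (if r = n then 1 / 2 ^ n else 0)" if "r \<le> n" for r
  proof (cases "r = n")
    case True
    obtain k where "n = Suc k" using assms by (cases n) auto
    then show ?thesis using True card_polys_const_nz_0 by simp
  next
    case False
    then have "n - 1 = r + (n - r - 1)" using that by simp
    then have "(2::real) ^ (n - 1) = 2 ^ r * 2 ^ (n - r - 1)" by (metis power_add)
    then show ?thesis using False that card_polys_const_nz[of "n - r"] by simp
  qed
  have "measure_pmf.prob (pmf_of_set (polys_const_nz n)) {P. almost_irreducible P} =
    (\<Sum>r=Suc (n div 2)..n. I r * (real (card (polys_const_nz (n - r))) / 2 ^ (n - 1)))"
    using assms finite_polys_const_nz[of n] card_polys_const_nz[of n]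
    by (simp add: measure_pmf_of_set card_almost_irreducible I_def sum_divide_distrib)
  also have "\<dots> = (\<Sum>r=Suc (n div 2)..n. I r / 2 ^ r + (if r = n then I r / 2 ^ n else 0))"
  proof (rule sum.cong[OF refl])
    fix r assume "r \<in> {Suc (n div 2)..n}"
    then have "r \<le> n" by simp
    then show "I r * (real (card (polys_const_nz (n - r))) / 2 ^ (n - 1)) =
        I r / 2 ^ r + (if r = n then I r / 2 ^ n else 0)"
      unfolding weight[OF \<open>r \<le> n\<close>] by (simp add: distrib_left)
  qed
  also have "\<dots> = (\<Sum>r=Suc (n div 2)..n. I r / 2 ^ r) + I n / 2 ^ n"
    using assms by (simp add: sum.distrib)
  finally show ?thesis by (simp add: I_def)
qed

section \<open>Estimating a piece of the harmonic series\<close>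

lemma sum_inverse_bounds:
  fixes m n :: nat
  assumes "0 < m" "m \<le> n"
  shows "(\<Sum>r=Suc m..n. 1 / real r) \<le> ln n - ln m"
    and "ln n - ln m - (1 / m - 1 / n) \<le> (\<Sum>r=Suc m..n. 1 / real r)"
proof -
  have "(\<Sum>r=Suc m..n. 1 / real r) \<le> ln n - ln m \<and>
      ln n - ln m - (1 / m - 1 / n) \<le> (\<Sum>r=Suc m..n. 1 / real r)"
    using assms(2)
  proof (induction n rule: dec_induct)
    case base
    then show ?case by simp
  next
    case (step k)
    then have k: "0 < real k" using assms(1) by simp
    \<comment> \<open>The increment of \<open>ln\<close> lies between 1/(k+1) and 1/k. The gap 1/k -
      1/(k+1) telescopes to the correction \<open>1 / m - 1 / n\<close>.\<close>
    have "ln (Suc k) - ln k \<le> 1 / real k"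
      using ln_diff_le[of "real (Suc k)" "real k"] k by simp
    moreover have "ln k - ln (Suc k) \<le> - 1 / real (Suc k)"
      using ln_diff_le[of "real k" "real (Suc k)"] k by simp
    moreover have "(\<Sum>r=Suc m..Suc k. 1 / real r) = (\<Sum>r=Suc m..k. 1 / real r) + 1 / real (Suc k)"
      using step.hyps by (subst sum.nat_ivl_Suc') auto
    ultimately show ?case using step.IH by linarith
  qed
  then show "(\<Sum>r=Suc m..n. 1 / real r) \<le> ln n - ln m"
    and "ln n - ln m - (1 / m - 1 / n) \<le> (\<Sum>r=Suc m..n. 1 / real r)" by auto
qed

lemma sum_inverse_upper_half:
  assumes "n \<ge> 2"
  shows "\<bar>(\<Sum>r=Suc (n div 2)..n. 1 / real r) - ln 2\<bar> \<le> 3 / real n"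
proof -
  define m where "m = n div 2"
  \<comment> \<open>The bound \<open>n \<le> 3 * m\<close>, attained at n = 3, turns errors in 1/m
    into the 3/n of the claim. The parity of \<open>n\<close> affects ln n - ln m by at most
    1/(2m).\<close>
  have m: "0 < m" "m \<le> n" "2 * m \<le> n" "n \<le> 2 * m + 1" "n \<le> 3 * m" using assms by (auto simp: m_def)
  have ln2m: "ln (2 * real m) = ln 2 + ln m" using m by (simp add: ln_mult)
  have ge: "ln 2 \<le> ln n - ln m"
    using m ln2m ln_le_cancel_iff[of "2 * real m" "real n"] by simp
  have "ln n - ln (2 * real m) \<le> (real n - 2 * real m) / (2 * real m)"
    using m by (intro ln_diff_le) auto
  also have "\<dots> \<le> 1 / (2 * real m)" using m by (intro divide_right_mono) auto
  also have "\<dots> \<le> 3 / real n" using m by (simp add: field_simps)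
  finally have le: "ln n - ln m \<le> ln 2 + 3 / real n" using ln2m by simp
  have "1 / real m \<le> 3 / real n" using m by (simp add: field_simps)
  then show ?thesis
    using sum_inverse_bounds[OF m(1,2)] ge le by (auto simp: abs_le_iff simp flip: m_def)
qed

theorem corollary9p3:
  shows "\<exists>C::real. \<forall>n\<ge>1.
    \<bar>measure_pmf.prob (pmf_of_set (polys_const_nz n)) {P. almost_irreducible P} - ln 2\<bar>
      \<le> C / real n"
proof (intro exI[of _ 20] allI impI)
  fix n :: nat
  assume n: "n \<ge> 1"
  define p where "p = measure_pmf.prob (pmf_of_set (polys_const_nz n)) {P. almost_irreducible P}"
  \<comment> \<open>The constant is 20 = 16 + 3 + 1. Since 2r >= n, each density error 4/r^2 is at
    most 16/n^2, and there are at most \<open>n\<close> of them; 3/n comes from the harmonic sum and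
    1/n from the extra term for r = n.\<close>
  have "\<bar>p - ln 2\<bar> \<le> 20 / real n"
  proof (cases "n \<ge> 2")
    case False
    \<comment> \<open>For n = 1 it suffices that both numbers lie between 0 and 1.\<close>
    have "0 \<le> p" "p \<le> 1" by (auto simp: p_def)
    moreover have "0 \<le> ln (2::real)" "ln (2::real) \<le> 1" using ln_le_minus_one[of "2::real"] by auto
    ultimately have "\<bar>p - ln 2\<bar> \<le> 20" by linarith
    moreover have "n = 1" using False n by simp
    ultimately show ?thesis by simp
  next
    case True
    define I where "I r = real (card (irreducibles_of_degree r)) / 2 ^ r" for r
    define A where "A = {Suc (n div 2)..n}"
    have p: "p = (\<Sum>r\<in>A. I r) + I n"
      unfolding p_def I_def A_def by (rule prob_almost_irreducible[OF True])
    have "\<bar>(\<Sum>r\<in>A. I r) - (\<Sum>r\<in>A. 1 / real r)\<bar> \<le> (\<Sum>r\<in>A. \<bar>I r - 1 / real r\<bar>)"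
      by (simp only: sum_abs flip: sum_subtractf)
    also have "\<dots> \<le> (\<Sum>r\<in>A. 16 / real n ^ 2)"
    proof (rule sum_mono)
      fix r assume r: "r \<in> A"
      then have "\<bar>I r - 1 / real r\<bar> \<le> 4 / real r ^ 2"
        unfolding I_def by (intro irreducibles_density) (auto simp: A_def)
      also have "\<dots> = 16 / (2 * real r) ^ 2" by (simp add: power_mult_distrib)
      also have "\<dots> \<le> 16 / real n ^ 2"
        using r True by (intro divide_left_mono power_mono) (auto simp: A_def)
      finally show "\<bar>I r - 1 / real r\<bar> \<le> 16 / real n ^ 2" .
    qed
    also have "\<dots> = real (card A) * (16 / real n ^ 2)" by simp
    also have "\<dots> \<le> real n * (16 / real n ^ 2)"
      by (intro mult_right_mono) (auto simp: A_def)
    also have "\<dots> = 16 / real n" by (simp add: power2_eq_square)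
    finally have "\<bar>(\<Sum>r\<in>A. I r) - (\<Sum>r\<in>A. 1 / real r)\<bar> \<le> 16 / real n" .
    moreover have "\<bar>(\<Sum>r\<in>A. 1 / real r) - ln 2\<bar> \<le> 3 / real n"
      unfolding A_def by (rule sum_inverse_upper_half[OF True])
    moreover have "0 \<le> I n" "I n \<le> 1 / real n"
      using irreducibles_density(2)[OF n] by (auto simp: I_def)
    moreover have "16 / real n + 3 / real n + 1 / real n = 20 / real n" by (simp flip: add_divide_distrib)
    ultimately show ?thesis unfolding p abs_le_iff by linarith
  qed
  then show "\<bar>measure_pmf.prob (pmf_of_set (polys_const_nz n)) {P. almost_irreducible P} - ln 2\<bar>
      \<le> 20 / real n" by (simp add: p_def)
qed

end
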